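(* Let $0<\rho<1$, let $\Omega=\{z\in\mathbb{C}:\rho<|z|<1\}$ be the annulus with boundary $\Gamma$, let $t>0$, and let $S_\rho^t(z,a)$ be the weighted Szegő kernel for $\Omega$. Put $$\mu=\frac{\ln t+i\pi}{2\ln\rho},\qquad \nu=1+\frac{-\ln t+i\pi}{2\ln\rho}.$$ Then for all $a\in\Omega$ and $z\in\Omega\cup\Gamma$, $$S_\rho^t(z,a)=\frac{\Gamma_{\rho^2}(\mu)\,\Gamma_{\rho^2}(\nu)\,\theta(-t\overline{a}z;\rho^2)}{2\pi(1-\rho^2)^{2-\mu-\nu}\,\theta(\overline{a}z;\rho^2)}.$$
   Context: For $t>0$ the weighted Szegő kernel for $\Omega$ is defined by $$S_\rho^t(z,a)=\frac{1}{2\pi}\sum_{n=-\infty}^{\infty}\frac{(\overline{a}z)^n}{1+t\rho^{2n}},\qquad a\in\Omega,\ z\in\Omega\cup\Gamma,$$ where $\Gamma$ consists of the circles $|z|=1$ and $|z|=\rho$ (the series converges since $\rho^2<|\overline{a}z|<1$). For $0<q<1$ and $\alpha\in\mathbb{C}$, $(\alpha;q)_\infty=\prod_{n=0}^\infty(1-\alpha q^n)$. The $q$-gamma (basic gamma) function is $$\Gamma_q(x)=\frac{(q;q)_\infty}{(q^x;q)_\infty}(1-q)^{1-x},$$ for complex $x$ with $(q^x;q)_\infty\neq0$, where for a positive real $c$ and complex $x$, $c^x=e^{x\ln c}$. The modified Jacobi theta function is $\theta(x;q)=(x;q)_\infty(q/x;q)_\infty$ for $x\ne0$. *)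

theory Defs
  imports "HOL-Analysis.Analysis"
begin

definition annulus :: "real \<Rightarrow> complex set" where
  "annulus \<rho> = {z. \<rho> < norm z \<and> norm z < 1}"

definition annulus_boundary :: "real \<Rightarrow> complex set" where
  "annulus_boundary \<rho> = {z. norm z = 1} \<union> {z. norm z = \<rho>}"

text \<open>The bilateral series is an unordered sum over the integers. For \<open>0 < \<rho> < 1\<close>, \<open>t > 0\<close>, \<open>a\<close> in the
  annulus and \<open>z\<close> in the closed annulus one has \<open>\<rho>\<^sup>2 < norm (cnj a * z) < 1\<close>, so it converges
  absolutely.\<close>

definition weighted_szego :: "real \<Rightarrow> real \<Rightarrow> complex \<Rightarrow> complex \<Rightarrow> complex" where
  "weighted_szego \<rho> t z a =
     1 / (2 * of_real pi) *
     (\<Sum>\<^sub>\<infinity>n\<in>(UNIV::int set). (cnj a * z) powi n / of_real (1 + t * \<rho> powi (2 * n)))"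

definition q_pochhammer_inf :: "complex \<Rightarrow> real \<Rightarrow> complex" where
  "q_pochhammer_inf \<alpha> q = (\<Prod>n. 1 - \<alpha> * of_real q ^ n)"

text \<open>The base of each \<open>powr\<close> is a positive real when \<open>0 < q < 1\<close>, so \<open>powr\<close> with the principal logarithm
  is \<open>exp (x * ln c)\<close>. At poles the value is \<open>0\<close> by the convention for division.\<close>

definition q_Gamma :: "real \<Rightarrow> complex \<Rightarrow> complex" where
  "q_Gamma q x =
     q_pochhammer_inf (of_real q) q / q_pochhammer_inf (of_real q powr x) q *
     of_real (1 - q) powr (1 - x)"

definition q_theta :: "complex \<Rightarrow> real \<Rightarrow> complex" where
  "q_theta x q = q_pochhammer_inf x q * q_pochhammer_inf (of_real q / x) q"

end

theory Submission
  imports Defs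
begin

text \<open>
  Put \<open>q = \<rho>\<^sup>2\<close> and \<open>w = cnj a * z\<close>, so \<open>q < norm w < 1\<close>. Since \<open>2 * ln \<rho> = ln q\<close>, the parameters
  are chosen so that \<open>q powr \<mu> = - t\<close> and \<open>q powr \<nu> = - q / t\<close>; the two q-gamma factors therefore
  combine to \<open>(q;q)\<^sup>2 / \<theta>(- t; q)\<close> times the power of \<open>1 - q\<close>, and the claim becomes the bilateral
  identity
  \<open>\<Sum>n. w powi n / (1 + t * q powi n) = (q;q)\<^sup>2 * \<theta>(- t w; q) / (\<theta>(- t; q) * \<theta>(w; q))\<close>
  (due to Kronecker, and a case of Ramanujan's \<open>1\<psi>1\<close> sum), which is \<open>bilateral_sum\<close>.

  Write \<open>F w\<close> for the left-hand side. The idea is to multiply the Laurent series of \<open>F\<close> and of \<open>\<theta>\<close>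
  in their common annulus of convergence and to compare recurrences of coefficients. The coefficients
  \<open>C N\<close> of \<open>\<theta>\<close> satisfy \<open>C (N + 1) = - q powi N * C N\<close> (\<open>theta_coeff_rec\<close>); this is the content of the
  Jacobi triple product, up to the value of \<open>C 0 \<noteq> 0\<close>. The coefficients
  of \<open>F w * \<theta>(w)\<close> satisfy the same recurrence with \<open>q powi N\<close> replaced by \<open>- t * q powi N\<close>
  (\<open>product_coeff_rec\<close>), because the denominators \<open>1 + t q^n\<close> cancel and what remains is a multiple of
  the sum of the \<open>C k\<close>, that is, of \<open>\<theta>(1) = 0\<close>. These are the coefficients of a multiple of \<open>\<theta>(- t w)\<close>,
  so \<open>F w * \<theta>(w) = \<kappa> * \<theta>(- t w)\<close> (\<open>weight_theta_proportional\<close>). Finally, \<open>F\<close> has a simple pole and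
  \<open>\<theta>\<close> a simple zero at \<open>w = 1\<close>; letting \<open>w\<close> tend to \<open>1\<close> along the reals gives
  \<open>(q;q)\<^sup>2 = \<kappa> * \<theta>(- t)\<close>.
\<close>

section \<open>Summation over the integers\<close>

lemma summable_on_mult_bounded:
  fixes f g :: "'a \<Rightarrow> complex"
  assumes "g summable_on A" and "\<And>x. x \<in> A \<Longrightarrow> norm (f x) \<le> K"
  shows "(\<lambda>x. f x * g x) summable_on A"
proof -
  have "(\<lambda>x. norm (g x)) summable_on A"
    using assms(1) summable_on_iff_abs_summable_on_complex by blast
  then have "(\<lambda>x. K * norm (g x)) summable_on A"
    by (rule summable_on_cmult_right)
  then have "(\<lambda>x. norm (f x * g x)) summable_on A"
    by (rule Infinite_Sum.abs_summable_on_comparison_test') (simp add: norm_mult assms(2) mult_right_mono)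
  then show ?thesis
    using summable_on_iff_abs_summable_on_complex by blast
qed

lemma summable_on_imp_bounded:
  fixes f :: "'a \<Rightarrow> complex"
  assumes "f summable_on A"
  obtains K where "\<And>x. x \<in> A \<Longrightarrow> norm (f x) \<le> K"
proof -
  have s: "(\<lambda>x. norm (f x)) summable_on A"
    using assms summable_on_iff_abs_summable_on_complex by blast
  have "norm (f x) \<le> (\<Sum>\<^sub>\<infinity>x\<in>A. norm (f x))" if "x \<in> A" for x
    using finite_sum_le_infsum[OF s, of "{x}"] that by auto
  then show thesis by (rule that)
qed

lemma infsum_diff:
  fixes f g :: "'a \<Rightarrow> complex"
  assumes "f summable_on A" "g summable_on A"
  shows "(\<Sum>\<^sub>\<infinity>x\<in>A. f x - g x) = infsum f A - infsum g A"
  using infsum_add[OF assms(1) summable_on_uminus[THEN iffD2, OF assms(2)]]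
  by (simp add: infsum_uminus)

lemma summable_on_int_geometric:
  fixes r :: real
  assumes "0 \<le> r" "r < 1"
  shows "(\<lambda>n. r ^ nat \<bar>n\<bar>) summable_on (UNIV :: int set)"
proof -
  have nat: "(\<lambda>n. r ^ n) summable_on (UNIV :: nat set)"
    using assms by (simp add: summable_on_UNIV_nonneg_real_iff summable_geometric)
  have nat': "(\<lambda>n. r ^ Suc n) summable_on (UNIV :: nat set)"
    using summable_on_cmult_right[OF nat, of r] by simp
  have "bij_betw int UNIV {0..}"
    by (rule bij_betwI[where g = nat]) auto
  from summable_on_reindex_bij_betw[OF this, of "\<lambda>n. r ^ nat \<bar>n\<bar>"]
  have "(\<lambda>n. r ^ nat \<bar>n\<bar>) summable_on {0::int..}"
    using nat by simp
  moreover have "bij_betw (\<lambda>n. - 1 - int n) UNIV {..<0}"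
    by (rule bij_betwI[where g = "\<lambda>k. nat (- 1 - k)"]) auto
  from summable_on_reindex_bij_betw[OF this, of "\<lambda>n. r ^ nat \<bar>n\<bar>"]
  have "(\<lambda>n. r ^ nat \<bar>n\<bar>) summable_on {..<0::int}"
    using nat' by (simp add: abs_if nat_add_distrib)
  ultimately have "(\<lambda>n. r ^ nat \<bar>n\<bar>) summable_on ({0..} \<union> {..<0::int})"
    by (rule summable_on_Un_disjoint) auto
  moreover have "{0..} \<union> {..<0::int} = UNIV" by auto
  ultimately show ?thesis by simp
qed

lemma bij_int_shift: "bij (\<lambda>k. k + c :: int)"
  by (rule bij_betwI[where g = "\<lambda>k. k - c"]) auto

lemma infsum_int_shift: "(\<Sum>\<^sub>\<infinity>k. f (k + c)) = (\<Sum>\<^sub>\<infinity>k::int. f k)"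
  by (rule infsum_reindex_bij_betw[OF bij_int_shift])

lemma summable_on_int_shift_iff: "(\<lambda>k. f (k + c)) summable_on UNIV \<longleftrightarrow> f summable_on (UNIV :: int set)"
  by (rule summable_on_reindex_bij_betw[OF bij_int_shift])

lemma bij_int_uminus: "bij (uminus :: int \<Rightarrow> int)"
  by (rule bij_betwI[where g = uminus]) auto

text \<open>The product of two bilateral series, grouped by the difference of the two indices. With the second
  series taken in powers of \<open>1 / w\<close>, this is multiplication of Laurent series.\<close>

lemma has_sum_int_correlation:
  fixes f g :: "int \<Rightarrow> complex"
  assumes f: "f summable_on UNIV" and g: "g summable_on UNIV"
  shows "((\<lambda>N. \<Sum>\<^sub>\<infinity>k. f (N + k) * g k) has_sum (infsum f UNIV * infsum g UNIV)) UNIV"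
proof -
  define h where "h = (\<lambda>(m, k). f m * g k)"
  have f': "(\<lambda>x. norm (f x)) summable_on UNIV" and g': "(\<lambda>x. norm (g x)) summable_on UNIV"
    using f g summable_on_iff_abs_summable_on_complex by blast+
  have "(\<lambda>p. norm (h p)) summable_on (UNIV \<times> UNIV)"
  proof (rule summable_on_SigmaI)
    show "((\<lambda>k. norm (h (m, k))) has_sum (norm (f m) * (\<Sum>\<^sub>\<infinity>k. norm (g k)))) UNIV" for m
      unfolding h_def by (simp add: norm_mult has_sum_cmult_right g')
    show "(\<lambda>m. norm (f m) * (\<Sum>\<^sub>\<infinity>k. norm (g k))) summable_on UNIV"
      using f' by (rule summable_on_cmult_left)
  qed auto
  then have h: "h summable_on (UNIV \<times> UNIV)"
    using summable_on_iff_abs_summable_on_complex by blast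
  have "infsum h (UNIV \<times> UNIV) = (\<Sum>\<^sub>\<infinity>m. \<Sum>\<^sub>\<infinity>k. h (m, k))"
    using infsum_Sigma_banach[OF h] by simp
  also have "\<dots> = infsum f UNIV * infsum g UNIV"
    unfolding h_def by (simp add: infsum_cmult_left f infsum_cmult_right g)
  finally have "(h has_sum (infsum f UNIV * infsum g UNIV)) (UNIV \<times> UNIV)"
    using h has_sum_infsum by fastforce
  moreover have "bij_betw (\<lambda>(N, k). (N + k, k)) (UNIV \<times> UNIV) (UNIV \<times> (UNIV :: int set))"
    by (rule bij_betwI[where g = "\<lambda>(m, k). (m - k, k)"]) auto
  ultimately have "((\<lambda>p. h (case p of (N, k) \<Rightarrow> (N + k, k))) has_sum
      (infsum f UNIV * infsum g UNIV)) (UNIV \<times> UNIV)"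
    by (subst has_sum_reindex_bij_betw)
  then show ?thesis
  proof (rule has_sum_SigmaD)
    fix N :: int
    obtain K where "\<And>x. norm (f x) \<le> K"
      using summable_on_imp_bounded[OF f] by auto
    then have "(\<lambda>k. f (N + k) * g k) summable_on UNIV"
      by (intro summable_on_mult_bounded[OF g])
    then show "((\<lambda>k. h (case (N, k) of (N, k) \<Rightarrow> (N + k, k))) has_sum
        (\<Sum>\<^sub>\<infinity>k. f (N + k) * g k)) UNIV"
      unfolding h_def by simp
  qed
qed

section \<open>Euler's expansion of the infinite q-shifted factorial\<close>

lemma convergent_prod_q_pochhammer:
  fixes q :: real
  assumes "0 < q" "q < 1"
  shows "convergent_prod (\<lambda>n. 1 - \<alpha> * complex_of_real q ^ n)"
proof -
  have "summable (\<lambda>n. norm \<alpha> * q ^ n)"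
    using assms by (intro summable_mult summable_geometric) auto
  then have "summable (\<lambda>n. norm ((1 - \<alpha> * complex_of_real q ^ n) - 1))"
    using assms by (simp add: norm_mult norm_power)
  then show ?thesis
    by (intro abs_convergent_prod_imp_convergent_prod summable_imp_abs_convergent_prod)
qed

lemma q_pochhammer_inf_nonzero:
  assumes "0 < q" "q < 1" "\<And>n. \<alpha> * complex_of_real q ^ n \<noteq> 1"
  shows "q_pochhammer_inf \<alpha> q \<noteq> 0"
  unfolding q_pochhammer_inf_def
proof (rule prodinf_nonzero[OF convergent_prod_q_pochhammer[OF assms(1,2)]])
  show "1 - \<alpha> * complex_of_real q ^ n \<noteq> 0" for n
    using assms(3)[of n] by auto
qed

text \<open>Solving \<open>euler_coeff_Suc\<close> from the value \<open>1\<close> at \<open>0\<close> gives the Taylor coefficients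
  \<open>(-1)^n q^(n (n - 1) / 2) / (q;q)_n\<close> of the product, as in Euler's theorem.\<close>

definition euler_coeff :: "real \<Rightarrow> nat \<Rightarrow> complex" where
  "euler_coeff q n = (\<Prod>i<n. - of_real (q ^ i) / of_real (1 - q ^ Suc i))"

context
  fixes q :: real
  assumes q: "0 < q" "q < 1"
begin

lemma q_power_less_1: "q ^ Suc n < 1"
  using q by (intro power_Suc_less_one)

lemma euler_coeff_Suc:
  "euler_coeff q (Suc n) * (1 - of_real q ^ Suc n) = - (of_real q ^ n) * euler_coeff q n"
proof -
  have "complex_of_real (1 - q ^ Suc n) \<noteq> 0"
    using q_power_less_1[of n] by (simp only: of_real_eq_0_iff)
  then have "euler_coeff q (Suc n) * of_real (1 - q ^ Suc n) = - of_real (q ^ n) * euler_coeff q n"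
    unfolding euler_coeff_def by simp
  then show ?thesis by simp
qed

lemma summable_euler: "summable (\<lambda>n. norm (euler_coeff q n * x ^ n))"
proof -
  have "(\<lambda>n. q ^ n * norm x / (1 - q)) \<longlonglongrightarrow> 0 * norm x / (1 - q)"
    using q by (intro tendsto_intros LIMSEQ_power_zero) auto
  then have "\<forall>\<^sub>F n in sequentially. q ^ n * norm x / (1 - q) < 1 / 2"
    by (rule order_tendstoD) simp
  then obtain N where N: "\<And>n. n \<ge> N \<Longrightarrow> q ^ n * norm x / (1 - q) < 1 / 2"
    by (auto simp: eventually_sequentially)
  show ?thesis
  proof (rule summable_ratio_test[where c = "1 / 2"])
    fix n assume n: "n \<ge> N"
    have le: "1 - q \<le> 1 - q ^ Suc n"
      using q power_decreasing[of 1 "Suc n" q] by simp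
    have "norm (euler_coeff q (Suc n)) = q ^ n / (1 - q ^ Suc n) * norm (euler_coeff q n)"
      unfolding euler_coeff_def using q q_power_less_1[of n]
      by (simp add: norm_mult norm_divide norm_power del: power_Suc of_real_diff)
    also have "\<dots> \<le> q ^ n / (1 - q) * norm (euler_coeff q n)"
      using q le q_power_less_1[of n]
      by (intro mult_right_mono divide_left_mono mult_pos_pos) (auto simp del: power_Suc)
    finally have "norm (euler_coeff q (Suc n) * x ^ Suc n)
        \<le> q ^ n / (1 - q) * norm (euler_coeff q n) * norm (x ^ Suc n)"
      unfolding norm_mult by (rule mult_right_mono) simp
    also have "\<dots> = (q ^ n * norm x / (1 - q)) * norm (euler_coeff q n * x ^ n)"
      by (simp add: norm_mult norm_power)
    also have "\<dots> \<le> 1 / 2 * norm (euler_coeff q n * x ^ n)"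
      using N[OF n] by (intro mult_right_mono) auto
    finally show "norm (norm (euler_coeff q (Suc n) * x ^ Suc n))
        \<le> 1 / 2 * norm (norm (euler_coeff q n * x ^ n))" by simp
  qed simp
qed

lemma euler_functional_eq:
  "(\<Sum>n. euler_coeff q n * x ^ n) = (1 - x) * (\<Sum>n. euler_coeff q n * (of_real q * x) ^ n)"
proof -
  let ?a = "\<lambda>n. euler_coeff q n * x ^ n" and ?b = "\<lambda>n. euler_coeff q n * (of_real q * x) ^ n"
  have s: "summable ?a" "summable ?b"
    by (rule summable_norm_cancel[OF summable_euler])+
  have "suminf ?a - suminf ?b = (\<Sum>n. ?a n - ?b n)"
    using s by (rule suminf_diff)
  also have "\<dots> = (\<Sum>n. ?a (Suc n) - ?b (Suc n))"
    using suminf_split_head[OF summable_diff[OF s]] by simp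
  also have "(\<lambda>n. ?a (Suc n) - ?b (Suc n)) = (\<lambda>n. - x * ?b n)"
  proof
    fix n
    have "?a (Suc n) - ?b (Suc n) = euler_coeff q (Suc n) * (1 - of_real q ^ Suc n) * x ^ Suc n"
      by (simp only: power_mult_distrib) (simp add: algebra_simps)
    also have "\<dots> = - x * ?b n"
      unfolding euler_coeff_Suc by (simp add: power_mult_distrib)
    finally show "?a (Suc n) - ?b (Suc n) = - x * ?b n" .
  qed
  also have "(\<Sum>n. - x * ?b n) = - x * suminf ?b"
    by (rule suminf_mult[OF s(2)])
  finally show ?thesis
    by (simp add: algebra_simps)
qed

lemma isCont_euler: "isCont (\<lambda>x. \<Sum>n. euler_coeff q n * x ^ n) x"
  by (rule isCont_powser_converges_everywhere[OF summable_norm_cancel[OF summable_euler]])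

text \<open>The product and the series satisfy the same functional equation \<open>E x = (1 - x) * E (q x)\<close>; iterating
  it drives the argument to \<open>0\<close>, where the series is continuous with value \<open>1\<close>.\<close>

theorem q_pochhammer_inf_euler:
  "q_pochhammer_inf x q = (\<Sum>n. euler_coeff q n * x ^ n)"
proof -
  let ?E = "\<lambda>x. \<Sum>n. euler_coeff q n * x ^ n"
  have iter: "?E x = (\<Prod>i<m. 1 - x * of_real q ^ i) * ?E (of_real q ^ m * x)" for m
  proof (induction m)
    case (Suc m)
    then show ?case
      using euler_functional_eq[of "of_real q ^ m * x"] by (simp add: mult_ac)
  qed simp
  have "(\<lambda>m. of_real q ^ m * x) \<longlonglongrightarrow> 0 * x"
    using q by (intro tendsto_intros LIMSEQ_power_zero) auto
  then have "(\<lambda>m. ?E (of_real q ^ m * x)) \<longlonglongrightarrow> ?E 0"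
    using isCont_tendsto_compose[OF isCont_euler, of "\<lambda>m. of_real q ^ m * x" "0 * x" sequentially]
    by (simp only: mult_zero_left)
  moreover have "?E 0 = 1"
    using powser_zero[of "euler_coeff q"] by (simp add: euler_coeff_def)
  ultimately have E: "(\<lambda>m. ?E (of_real q ^ m * x)) \<longlonglongrightarrow> 1" by simp
  have "(\<lambda>m. \<Prod>i\<le>m. 1 - x * of_real q ^ i) \<longlonglongrightarrow> q_pochhammer_inf x q"
    unfolding q_pochhammer_inf_def
    by (rule convergent_prod_LIMSEQ[OF convergent_prod_q_pochhammer[OF q]])
  from tendsto_mult[OF this LIMSEQ_Suc[OF E]]
  have "(\<lambda>m. ?E x) \<longlonglongrightarrow> q_pochhammer_inf x q"
    using iter[of "Suc m" for m] by (simp add: lessThan_Suc_atMost)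
  then show ?thesis
    by (simp add: LIMSEQ_const_iff)
qed

lemma q_pochhammer_inf_step: "q_pochhammer_inf x q = (1 - x) * q_pochhammer_inf (of_real q * x) q"
  unfolding q_pochhammer_inf_euler by (rule euler_functional_eq)

lemma isCont_q_pochhammer_inf: "isCont (\<lambda>x. q_pochhammer_inf x q) x"
  unfolding q_pochhammer_inf_euler by (rule isCont_euler)

end


section \<open>The Laurent expansion of theta\<close>

context
  fixes q :: real
  assumes q: "0 < q" "q < 1"
begin

text \<open>With the extension by \<open>0\<close>, the recurrence \<open>euler_int_step\<close> is valid at every integer, so index
  shifts in bilateral sums produce no boundary terms.\<close>

definition euler_int :: "int \<Rightarrow> complex" where
  "euler_int n = (if n < 0 then 0 else euler_coeff q (nat n))"

lemma nome_nonzero [simp]: "q \<noteq> 0"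
  using q by simp

lemma euler_int_step:
  "euler_int (n + 1) = of_real q powi (n + 1) * euler_int (n + 1) - of_real q powi n * euler_int n"
proof (cases "n < 0")
  case True
  then show ?thesis
    by (cases "n = -1") (auto simp: euler_int_def)
next
  case False
  then obtain m where m: "n = int m" by (metis nonneg_int_cases not_less)
  have "nat (int m + 1) = Suc m" by simp
  moreover have "of_real q powi (int m + 1) = complex_of_real q ^ Suc m"
    by (metis of_nat_Suc power_int_of_nat add.commute)
  ultimately show ?thesis
    using euler_coeff_Suc[OF q, of m] by (simp add: m euler_int_def algebra_simps)
qed

lemma has_sum_euler_int:
  "((\<lambda>n. euler_int n * x powi n) has_sum q_pochhammer_inf x q) UNIV"
proof -
  have "((\<lambda>n. euler_coeff q n * x ^ n) has_sum q_pochhammer_inf x q) UNIV"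
    using norm_summable_imp_has_sum[OF summable_euler[OF q, of x]]
      summable_sums[OF summable_norm_cancel[OF summable_euler[OF q, of x]]]
    by (simp add: q_pochhammer_inf_euler[OF q])
  moreover have "bij_betw int UNIV {0..}"
    by (rule bij_betwI[where g = nat]) auto
  from has_sum_reindex_bij_betw[OF this, of "\<lambda>n. euler_int n * x powi n"]
  have "((\<lambda>n. euler_coeff q n * x ^ n) has_sum S) UNIV \<longleftrightarrow>
      ((\<lambda>n. euler_int n * x powi n) has_sum S) {0..}" for S
    by (simp add: euler_int_def)
  ultimately have "((\<lambda>n. euler_int n * x powi n) has_sum q_pochhammer_inf x q) {0..}"
    by simp
  then show ?thesis
    by (rule has_sum_cong_neutral[THEN iffD1, rotated -1]) (auto simp: euler_int_def)
qed

lemma summable_euler_int: "(\<lambda>n. euler_int n * x powi n) summable_on UNIV"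
  using has_sum_euler_int by (rule has_sum_imp_summable)

lemma euler_int_bounded: obtains K where "\<And>n. norm (euler_int n) \<le> K"
  using summable_on_imp_bounded[OF summable_euler_int[of 1]] by auto

text \<open>The coefficient of \<open>w powi N\<close> in the product of the Euler expansions of \<open>(w;q)\<close> and \<open>(q / w;q)\<close>.\<close>

definition theta_coeff :: "int \<Rightarrow> complex" where
  "theta_coeff N = (\<Sum>\<^sub>\<infinity>k. euler_int (N + k) * (euler_int k * of_real q powi k))"

lemma theta_laurent:
  assumes "w \<noteq> 0"
  shows "((\<lambda>N. theta_coeff N * w powi N) has_sum q_theta w q) UNIV"
proof -
  let ?f = "\<lambda>n. euler_int n * w powi n" and ?g = "\<lambda>n. euler_int n * (of_real q / w) powi n"
  have "((\<lambda>N. \<Sum>\<^sub>\<infinity>k. ?f (N + k) * ?g k) has_sum (infsum ?f UNIV * infsum ?g UNIV)) UNIV"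
    by (rule has_sum_int_correlation[OF summable_euler_int summable_euler_int])
  moreover have "infsum ?f UNIV * infsum ?g UNIV = q_theta w q"
    unfolding q_theta_def using infsumI[OF has_sum_euler_int] by simp
  moreover have "(\<Sum>\<^sub>\<infinity>k. ?f (N + k) * ?g k) = theta_coeff N * w powi N" for N
  proof -
    have "?f (N + k) * ?g k = euler_int (N + k) * (euler_int k * of_real q powi k) * w powi N" for k
      using assms by (simp add: power_int_add power_int_divide_distrib)
    then have "(\<Sum>\<^sub>\<infinity>k. ?f (N + k) * ?g k)
        = (\<Sum>\<^sub>\<infinity>k. euler_int (N + k) * (euler_int k * of_real q powi k) * w powi N)"
      by (rule infsum_cong)
    then show ?thesis
      by (simp only: theta_coeff_def infsum_cmult_left')
  qed
  ultimately show ?thesis by simp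
qed

text \<open>The triple product recurrence. Applying \<open>euler_int_step\<close> to the first Euler factor in
  \<open>theta_coeff (N + 1)\<close> and to the second one in \<open>theta_coeff N\<close> makes the summand of
  \<open>theta_coeff (N + 1) + q powi N * theta_coeff N\<close> a difference \<open>T k - T (k - 1)\<close>, whose sum over all
  integers vanishes.\<close>

lemma theta_coeff_rec: "theta_coeff (N + 1) = - (of_real q powi N) * theta_coeff N"
proof -
  define T where "T k = of_real q powi (N + 2 * k + 1) * (euler_int (N + k + 1) * euler_int k)" for k
  obtain K where K: "\<And>n. norm (euler_int n) \<le> K"
    using euler_int_bounded by blast
  have s: "(\<lambda>k. euler_int (M + k) * (euler_int k * of_real q powi k)) summable_on UNIV" for M
    by (rule summable_on_mult_bounded[OF summable_euler_int]) (rule K)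
  \<comment> \<open>\<open>T\<close> is summable because it is an Euler expansion at the argument \<open>q\<^sup>2\<close> with bounded factors.\<close>
  have "(\<lambda>k. euler_int (N + 1 + k) * (euler_int k * (of_real q ^ 2) powi k)) summable_on UNIV"
    by (rule summable_on_mult_bounded[OF summable_euler_int]) (rule K)
  then have "(\<lambda>k. of_real q powi (N + 1) *
      (euler_int (N + 1 + k) * (euler_int k * (of_real q ^ 2) powi k))) summable_on UNIV"
    by (rule summable_on_cmult_right)
  moreover have "of_real q powi (N + 1) *
      (euler_int (N + 1 + k) * (euler_int k * (of_real q ^ 2) powi k)) = T k" for k
  proof -
    have "complex_of_real q powi (N + 2 * k + 1) = of_real q powi (N + 1) * (of_real q ^ 2) powi k"
      by (simp add: power_int_add power_int_mult)
    then show ?thesis by (simp add: T_def algebra_simps)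
  qed
  ultimately have T: "T summable_on UNIV" by simp
  then have T': "(\<lambda>k. T (k + (-1))) summable_on UNIV"
    by (simp only: summable_on_int_shift_iff)
  have split: "euler_int (N + 1 + k) * (euler_int k * of_real q powi k) +
      of_real q powi N * (euler_int (N + k) * (euler_int k * of_real q powi k)) = T k - T (k + (-1))" for k
  proof -
    let ?x = "of_real q powi N :: complex" and ?y = "of_real q powi k :: complex"
    let ?Q = "complex_of_real q"
    have 1: "euler_int (N + k + 1) = ?x * ?y * ?Q * euler_int (N + k + 1) - ?x * ?y * euler_int (N + k)"
      using euler_int_step[of "N + k"] by (simp add: power_int_add)
    have 2: "euler_int k = ?y * euler_int k - ?y / ?Q * euler_int (k - 1)"
      using euler_int_step[of "k - 1"] by (simp add: power_int_diff)
    have "complex_of_real q powi (N + 2 * k + 1) = of_real q powi (N + (k + (k + 1)))"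
      by (simp add: algebra_simps)
    also have "\<dots> = ?x * ?y * ?y * ?Q"
      by (simp only: power_int_add of_real_eq_0_iff nome_nonzero simp_thms power_int_1_right mult.assoc)
    finally have t1: "T k = ?x * ?y * ?y * ?Q * (euler_int (N + k + 1) * euler_int k)"
      unfolding T_def by simp
    have "complex_of_real q powi (N + 2 * (k + -1) + 1) = of_real q powi (N + (k + (k - 1)))"
      by (simp add: algebra_simps)
    also have "\<dots> = ?x * ?y * ?y / ?Q"
      by (simp only: power_int_add power_int_diff of_real_eq_0_iff nome_nonzero simp_thms
          power_int_1_right mult.assoc times_divide_eq_right)
    finally have t2: "T (k + (-1)) = ?x * ?y * ?y / ?Q * (euler_int (N + k) * euler_int (k - 1))"
      unfolding T_def by simp
    have "euler_int (N + 1 + k) * (euler_int k * ?y) + ?x * (euler_int (N + k) * (euler_int k * ?y))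
       = euler_int (N + k + 1) * (euler_int k * ?y)
          + ?x * ?y * euler_int (N + k) * (?y * euler_int k - ?y / ?Q * euler_int (k - 1))"
      by (subst (2) 2) (simp add: algebra_simps)
    also have "\<dots> = (euler_int (N + k + 1) + ?x * ?y * euler_int (N + k)) * euler_int k * ?y
        - ?x * ?y * ?y / ?Q * (euler_int (N + k) * euler_int (k - 1))"
      by (simp add: algebra_simps)
    also have "euler_int (N + k + 1) + ?x * ?y * euler_int (N + k) = ?x * ?y * ?Q * euler_int (N + k + 1)"
      by (subst 1) simp
    also have "\<dots> * euler_int k * ?y - ?x * ?y * ?y / ?Q * (euler_int (N + k) * euler_int (k - 1))
        = T k - T (k + (-1))"
      unfolding t1 t2 by (simp add: algebra_simps)
    finally show ?thesis .
  qed
  have "theta_coeff (N + 1) + of_real q powi N * theta_coeff N = (\<Sum>\<^sub>\<infinity>k. T k - T (k + (-1)))"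
    unfolding theta_coeff_def
    by (simp only: split[symmetric] infsum_add[OF s summable_on_cmult_right[OF s]] infsum_cmult_right[OF s])
  also have "\<dots> = infsum T UNIV - (\<Sum>\<^sub>\<infinity>k. T (k + (-1)))"
    by (rule infsum_diff[OF T T'])
  also have "\<dots> = 0"
    by (simp only: infsum_int_shift) simp
  finally show ?thesis
    by (simp add: add_eq_0_iff)
qed

lemma q_theta_nonzero:
  assumes "\<And>n. w \<noteq> of_real q powi n" "w \<noteq> 0"
  shows "q_theta w q \<noteq> 0"
proof -
  have "w * of_real q ^ n \<noteq> 1" for n
    using assms(1)[of "- int n"] by (auto simp: power_int_minus divide_simps split: if_splits)
  moreover have "of_real q / w * of_real q ^ n \<noteq> 1" for n
  proof -
    have "w \<noteq> of_real q ^ Suc n"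
      using assms(1)[of "int (Suc n)"] by (simp only: power_int_of_nat not_False_eq_True)
    then show ?thesis using assms(2) by (simp add: field_simps)
  qed
  ultimately show ?thesis
    unfolding q_theta_def using q by (simp add: q_pochhammer_inf_nonzero)
qed

section \<open>The bilateral series\<close>

context
  fixes t :: real
  assumes t: "0 < t"
begin

definition weight :: "int \<Rightarrow> complex" where
  "weight n = 1 / of_real (1 + t * q powi n)"

lemma denominator_pos: "1 + t * q powi n > 0"
  using t q by (simp add: add_pos_pos)

lemma weight_mult: "weight n * (1 + of_real t * of_real q powi n) = 1"
proof -
  have "complex_of_real (1 + t * q powi n) \<noteq> 0"
    using denominator_pos[of n] by (simp only: of_real_eq_0_iff)
  moreover have "1 + of_real t * of_real q powi n = complex_of_real (1 + t * q powi n)"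
    by simp
  ultimately show ?thesis
    by (simp only: weight_def times_divide_eq_left mult_1 divide_self not_False_eq_True)
qed

lemma norm_weight: "norm (weight n) = 1 / (1 + t * q powi n)"
  unfolding weight_def norm_divide norm_of_real using denominator_pos[of n] by simp

lemma norm_weight_le_1: "norm (weight n) \<le> 1"
  unfolding norm_weight using t q denominator_pos[of n] by (simp add: divide_le_eq_1)

lemma norm_weight_le: "norm (weight n) \<le> inverse t * q powi (- n)"
proof -
  have "1 / (1 + t * q powi n) \<le> 1 / (t * q powi n)"
    using t q by (intro divide_left_mono) (auto simp: add_pos_pos)
  then show ?thesis
    unfolding norm_weight by (simp add: power_int_minus field_simps)
qed

text \<open>Pulling out the constant limit \<open>1\<close> of the weights at \<open>+\<infinity>\<close> leaves this remainder, which decays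
  geometrically in both directions.\<close>

definition weight_rest :: "int \<Rightarrow> complex" where
  "weight_rest n = (if n < 0 then weight n else weight n - 1)"

lemma norm_weight_rest: "norm (weight_rest n) \<le> max t (inverse t) * q ^ nat \<bar>n\<bar>"
proof (cases "n < 0")
  case True
  have "norm (weight_rest n) \<le> inverse t * q powi (- n)"
    using norm_weight_le[of n] True by (simp add: weight_rest_def)
  also have "q powi (- n) = q ^ nat \<bar>n\<bar>"
    using True by (simp add: power_int_def)
  finally show ?thesis
    by (rule order_trans) (use q in \<open>auto intro: mult_right_mono\<close>)
next
  case False
  have "weight n - 1 = - (of_real t * of_real q powi n * weight n)"
    using weight_mult[of n] by (simp add: algebra_simps)
  then have "norm (weight_rest n) = norm (complex_of_real t * of_real q powi n) * norm (weight n)"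
    using False by (simp only: weight_rest_def norm_minus_cancel norm_mult if_False)
  also have "\<dots> \<le> norm (complex_of_real t * of_real q powi n) * 1"
    by (rule mult_left_mono[OF norm_weight_le_1]) simp
  also have "\<dots> = t * q powi n"
    using t q by (simp add: norm_mult norm_power_int)
  also have "q powi n = q ^ nat \<bar>n\<bar>"
    using False by (simp add: power_int_def)
  finally show ?thesis
    by (rule order_trans) (use q in \<open>auto intro: mult_right_mono\<close>)
qed

lemma rest_term_bound:
  assumes "q < norm w" "norm w \<le> 1"
  shows "norm (weight_rest n * w powi n) \<le> max t (inverse t) * (q / norm w) ^ nat \<bar>n\<bar>"
proof -
  have w: "norm w > 0" using assms q by linarith
  have "norm (w powi n) \<le> (1 / norm w) ^ nat \<bar>n\<bar>"
  proof (cases "n < 0")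
    case True
    then show ?thesis by (simp add: norm_power_int power_int_def inverse_eq_divide norm_power norm_divide)
  next
    case False
    have "norm w ^ nat n \<le> 1" using assms by (simp add: power_le_one)
    also have "1 \<le> (1 / norm w) ^ nat n"
      using assms w by (intro one_le_power) simp
    finally show ?thesis using False by (simp add: norm_power power_int_def)
  qed
  then have "norm (weight_rest n) * norm (w powi n)
      \<le> (max t (inverse t) * q ^ nat \<bar>n\<bar>) * (1 / norm w) ^ nat \<bar>n\<bar>"
    using norm_weight_rest[of n] by (intro mult_mono) (use t q in auto)
  also have "\<dots> = max t (inverse t) * (q / norm w) ^ nat \<bar>n\<bar>"
    by (simp add: power_divide)
  finally show ?thesis by (simp add: norm_mult)
qed

lemma summable_rest:
  assumes "q < norm w" "norm w \<le> 1"
  shows "(\<lambda>n. weight_rest n * w powi n) summable_on UNIV"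
proof -
  have w: "norm w > 0" using assms q by linarith
  have "(\<lambda>n. max t (inverse t) * (q / norm w) ^ nat \<bar>n\<bar>) summable_on (UNIV :: int set)"
    using assms w q by (intro summable_on_cmult_right summable_on_int_geometric) auto
  then have "(\<lambda>n. norm (weight_rest n * w powi n)) summable_on UNIV"
    by (rule Infinite_Sum.abs_summable_on_comparison_test') (rule rest_term_bound[OF assms])
  then show ?thesis
    using summable_on_iff_abs_summable_on_complex by blast
qed

text \<open>This splitting isolates the pole at \<open>w = 1\<close>: the remaining series converges on the unit circle
  as well.\<close>

lemma has_sum_weight:
  assumes "q < norm w" "norm w < 1"
  shows "((\<lambda>n. weight n * w powi n) has_sum
           (1 / (1 - w) + (\<Sum>\<^sub>\<infinity>n. weight_rest n * w powi n))) UNIV"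
proof -
  have "(\<lambda>n. w ^ n) sums (1 / (1 - w))" "summable (\<lambda>n. norm (w ^ n))"
    using assms by (auto simp: geometric_sums norm_power summable_geometric)
  then have "((\<lambda>n. w ^ n) has_sum (1 / (1 - w))) UNIV"
    by (rule norm_summable_imp_has_sum[rotated])
  moreover have "bij_betw int UNIV {0..}"
    by (rule bij_betwI[where g = nat]) auto
  from has_sum_reindex_bij_betw[OF this, of "\<lambda>n. (if n < 0 then 0 else 1) * w powi n" "1 / (1 - w)"]
  have "((\<lambda>n. w ^ n) has_sum (1 / (1 - w))) UNIV \<longleftrightarrow>
      ((\<lambda>n. (if n < 0 then 0 else 1) * w powi n) has_sum (1 / (1 - w))) {0..}"
    by simp
  ultimately have "((\<lambda>n. (if n < 0 then 0 else 1) * w powi n) has_sum (1 / (1 - w))) {0..}"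
    by simp
  then have "((\<lambda>n. (if n < 0 then 0 else 1) * w powi n) has_sum (1 / (1 - w))) UNIV"
    by (rule has_sum_cong_neutral[THEN iffD1, rotated -1]) auto
  moreover have "((\<lambda>n. weight_rest n * w powi n) has_sum (\<Sum>\<^sub>\<infinity>n. weight_rest n * w powi n)) UNIV"
    using assms by (intro has_sum_infsum summable_rest) auto
  ultimately have "((\<lambda>n. (if n < 0 then 0 else 1) * w powi n + weight_rest n * w powi n) has_sum
           (1 / (1 - w) + (\<Sum>\<^sub>\<infinity>n. weight_rest n * w powi n))) UNIV"
    by (rule has_sum_add)
  moreover have "(if n < 0 then 0 else 1) * w powi n + weight_rest n * w powi n = weight n * w powi n" for n
    by (simp add: weight_rest_def algebra_simps)
  ultimately show ?thesis by simp
qed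

definition product_coeff :: "int \<Rightarrow> complex" where
  "product_coeff N = (\<Sum>\<^sub>\<infinity>k. weight (N + k) * theta_coeff (- k))"

lemma product_laurent:
  assumes "q < norm w" "norm w < 1"
  shows "((\<lambda>N. product_coeff N * w powi N) has_sum
           ((\<Sum>\<^sub>\<infinity>n. weight n * w powi n) * q_theta w q)) UNIV"
proof -
  have w: "w \<noteq> 0" using assms q by auto
  let ?f = "\<lambda>n. weight n * w powi n" and ?g = "\<lambda>n. theta_coeff (- n) * w powi (- n)"
  have g: "(?g has_sum q_theta w q) UNIV"
    using theta_laurent[OF w]
    by (subst has_sum_reindex_bij_betw[OF bij_int_uminus, of "\<lambda>n. theta_coeff n * w powi n"])
  have "((\<lambda>N. \<Sum>\<^sub>\<infinity>k. ?f (N + k) * ?g k) has_sum (infsum ?f UNIV * infsum ?g UNIV)) UNIV"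
    by (rule has_sum_int_correlation[OF has_sum_imp_summable[OF has_sum_weight[OF assms]]
          has_sum_imp_summable[OF g]])
  moreover have "(\<Sum>\<^sub>\<infinity>k. ?f (N + k) * ?g k) = product_coeff N * w powi N" for N
  proof -
    have "?f (N + k) * ?g k = weight (N + k) * theta_coeff (- k) * w powi N" for k
      using w by (simp add: power_int_add power_int_minus)
    then have "(\<Sum>\<^sub>\<infinity>k. ?f (N + k) * ?g k)
        = (\<Sum>\<^sub>\<infinity>k. weight (N + k) * theta_coeff (- k) * w powi N)"
      by (rule infsum_cong)
    then show ?thesis
      by (simp only: product_coeff_def infsum_cmult_left')
  qed
  ultimately show ?thesis using infsumI[OF g] by simp
qed

text \<open>This is \<open>\<theta>(1) = 0\<close>.\<close>

lemma theta_coeff_sum_zero: "((\<lambda>k. theta_coeff (c - k)) has_sum 0) UNIV"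
proof -
  have "q_theta 1 q = 0"
    unfolding q_theta_def using q_pochhammer_inf_step[OF q, of 1] by simp
  then have 1: "(theta_coeff has_sum 0) UNIV"
    using theta_laurent[of 1] by simp
  have "bij (\<lambda>k. c - k)"
    by (rule bij_betwI[where g = "\<lambda>k. c - k"]) auto
  from has_sum_reindex_bij_betw[OF this, of theta_coeff 0] 1 show ?thesis
    by simp
qed

text \<open>Shifting the index in \<open>product_coeff (N + 1)\<close> leaves the weights as they are in
  \<open>product_coeff N\<close> and moves the shift to the theta coefficients. In the difference of the two sides the
  factor \<open>1 + t * q powi (N + k)\<close> then appears and cancels the weight, leaving \<open>\<theta>(1)\<close>.\<close>

lemma product_coeff_rec: "product_coeff (N + 1) = of_real t * of_real q powi N * product_coeff N"
proof -
  have s: "(\<lambda>k. weight (M + k) * theta_coeff (c - k)) summable_on UNIV" for M c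
    by (rule summable_on_mult_bounded[OF has_sum_imp_summable[OF theta_coeff_sum_zero]])
       (rule norm_weight_le_1)
  have s0: "(\<lambda>k. weight (N + k) * theta_coeff (- k)) summable_on UNIV"
    using s[of N 0] by simp
  have "product_coeff (N + 1) = (\<Sum>\<^sub>\<infinity>k. weight (N + 1 + (k + (-1))) * theta_coeff (- (k + (-1))))"
    unfolding product_coeff_def
    by (rule infsum_int_shift[symmetric, of "\<lambda>k. weight (N + 1 + k) * theta_coeff (- k)"])
  also have "\<dots> = (\<Sum>\<^sub>\<infinity>k. weight (N + k) * theta_coeff (1 - k))"
    by simp
  finally have "product_coeff (N + 1) - of_real t * of_real q powi N * product_coeff N
      = (\<Sum>\<^sub>\<infinity>k. weight (N + k) * theta_coeff (1 - k)
             - of_real t * of_real q powi N * (weight (N + k) * theta_coeff (- k)))"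
    unfolding product_coeff_def
    by (simp only: infsum_diff[OF s summable_on_cmult_right[OF s0]] infsum_cmult_right[OF s0])
  also have "\<dots> = (\<Sum>\<^sub>\<infinity>k. theta_coeff (1 - k))"
  proof (rule infsum_cong)
    fix k
    have th: "theta_coeff (1 - k) = - (of_real q powi (- k)) * theta_coeff (- k)"
      using theta_coeff_rec[of "- k"] by (simp add: add.commute)
    have "of_real t * of_real q powi N * (weight (N + k) * theta_coeff (- k))
        = - (of_real t * of_real q powi (N + k)) * weight (N + k) * theta_coeff (1 - k)"
      unfolding th by (simp add: power_int_add power_int_minus)
    then have "weight (N + k) * theta_coeff (1 - k)
             - of_real t * of_real q powi N * (weight (N + k) * theta_coeff (- k))
        = weight (N + k) * (1 + of_real t * of_real q powi (N + k)) * theta_coeff (1 - k)"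
      by (simp add: algebra_simps)
    then show "weight (N + k) * theta_coeff (1 - k)
             - of_real t * of_real q powi N * (weight (N + k) * theta_coeff (- k)) = theta_coeff (1 - k)"
      by (simp only: weight_mult mult_1)
  qed
  also have "\<dots> = 0"
    by (rule infsumI[OF theta_coeff_sum_zero])
  finally show ?thesis by simp
qed

lemma product_coeff_eq:
  "product_coeff N * theta_coeff 0 = product_coeff 0 * (theta_coeff N * (- of_real t) powi N)"
proof (induction N rule: int_induct[where k = 0])
  case base
  then show ?case by simp
next
  case (step1 N)
  have "product_coeff (N + 1) * theta_coeff 0
      = of_real t * of_real q powi N * (product_coeff N * theta_coeff 0)"
    by (simp add: product_coeff_rec)
  also have "\<dots> = product_coeff 0 * (theta_coeff (N + 1) * (- of_real t) powi (N + 1))"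
    unfolding step1.IH theta_coeff_rec using t by (simp add: power_int_add)
  finally show ?case .
next
  case (step2 N)
  have "of_real t * of_real q powi (N - 1) * (product_coeff (N - 1) * theta_coeff 0)
      = product_coeff N * theta_coeff 0"
    using product_coeff_rec[of "N - 1"] by simp
  also have "\<dots> = of_real t * of_real q powi (N - 1) *
      (product_coeff 0 * (theta_coeff (N - 1) * (- of_real t) powi (N - 1)))"
    unfolding step2.IH using t theta_coeff_rec[of "N - 1"] by (simp add: power_int_diff)
  finally show ?case using t q by simp
qed

lemma weight_theta_proportional:
  obtains \<kappa> where "\<And>w. q < norm w \<Longrightarrow> norm w < 1 \<Longrightarrow>
    (\<Sum>\<^sub>\<infinity>n. weight n * w powi n) * q_theta w q = \<kappa> * q_theta (- of_real t * w) q"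
proof -
  \<comment> \<open>Otherwise all coefficients vanish by the recurrence, but theta is not identically zero.\<close>
  have "theta_coeff 0 \<noteq> 0"
  proof
    assume 0: "theta_coeff 0 = 0"
    have all: "theta_coeff N = 0" for N
    proof (induction N rule: int_induct[where k = 0])
      case (step2 N)
      then show ?case using theta_coeff_rec[of "N - 1"] q by simp
    qed (use 0 in \<open>simp_all add: theta_coeff_rec\<close>)
    have "q_theta (- 1) q = 0"
      using infsumI[OF theta_laurent[of "- 1"]] all by simp
    moreover have "- 1 \<noteq> complex_of_real q powi n" for n
    proof -
      have "0 < q powi n" using q by simp
      then have "- 1 \<noteq> q powi n" by linarith
      then show ?thesis by (metis of_real_1 of_real_eq_iff of_real_minus of_real_power_int)
    qed
    ultimately show False using q_theta_nonzero[of "- 1"] by simp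
  qed
  show thesis
  proof (rule that)
    fix w :: complex assume w: "q < norm w" "norm w < 1"
    let ?F = "\<Sum>\<^sub>\<infinity>n. weight n * w powi n"
    have "- of_real t * w \<noteq> 0" using w q t by auto
    from has_sum_cmult_right[OF theta_laurent[OF this], of "product_coeff 0"]
    have "((\<lambda>N. product_coeff 0 * (theta_coeff N * (- of_real t * w) powi N))
        has_sum (product_coeff 0 * q_theta (- of_real t * w) q)) UNIV" .
    moreover have "product_coeff 0 * (theta_coeff N * (- of_real t * w) powi N)
        = theta_coeff 0 * (product_coeff N * w powi N)" for N
    proof -
      have "theta_coeff 0 * (product_coeff N * w powi N) = product_coeff N * theta_coeff 0 * w powi N"
        by simp
      then show ?thesis
        unfolding product_coeff_eq by (simp only: power_int_mult_distrib mult_ac)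
    qed
    ultimately have "((\<lambda>N. theta_coeff 0 * (product_coeff N * w powi N))
        has_sum (product_coeff 0 * q_theta (- of_real t * w) q)) UNIV" by simp
    moreover have "((\<lambda>N. theta_coeff 0 * (product_coeff N * w powi N))
        has_sum (theta_coeff 0 * (?F * q_theta w q))) UNIV"
      by (rule has_sum_cmult_right[OF product_laurent[OF w]])
    ultimately have "theta_coeff 0 * (?F * q_theta w q) = product_coeff 0 * q_theta (- of_real t * w) q"
      by (rule has_sum_unique[symmetric])
    then show "?F * q_theta w q = product_coeff 0 / theta_coeff 0 * q_theta (- of_real t * w) q"
      using \<open>theta_coeff 0 \<noteq> 0\<close> by (simp add: field_simps)
  qed
qed

lemma q_theta_minus_t_nonzero: "q_theta (- of_real t) q \<noteq> 0"
proof (rule q_theta_nonzero)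
  fix n
  have "0 < q powi n" using q by simp
  then have "- t \<noteq> q powi n" using t by linarith
  then show "- of_real t \<noteq> complex_of_real q powi n"
    by (metis of_real_eq_iff of_real_minus of_real_power_int)
qed (use t in auto)

lemma q_theta_ring_nonzero:
  assumes "q < norm w" "norm w < 1"
  shows "q_theta w q \<noteq> 0"
proof (rule q_theta_nonzero)
  fix n :: int
  show "w \<noteq> of_real q powi n"
  proof
    assume "w = of_real q powi n"
    then have "norm w = q powi n"
      using q by (simp add: norm_power_int)
    moreover have "q powi n \<ge> 1" if "n \<le> 0"
      using q that by (simp add: power_int_def one_le_inverse power_le_one)
    moreover have "q powi n \<le> q" if "n > 0"
    proof -
      have "q ^ nat n \<le> q ^ 1" using q that by (intro power_decreasing) auto
      then show ?thesis using that by (simp add: power_int_def)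
    qed
    ultimately show False using assms by fastforce
  qed
qed (use assms q in auto)

text \<open>The constant of proportionality is found by multiplying \<open>F\<close> by \<open>1 - w\<close> and dividing \<open>\<theta>\<close> by it, and
  letting \<open>w\<close> tend to \<open>1\<close> from the left.\<close>

theorem bilateral_sum:
  assumes w: "q < norm w" "norm w < 1"
  shows "(\<Sum>\<^sub>\<infinity>n. weight n * w powi n) =
    (q_pochhammer_inf (of_real q) q)\<^sup>2 * q_theta (- of_real t * w) q /
    (q_theta (- of_real t) q * q_theta w q)"
proof -
  let ?F = "\<lambda>w. \<Sum>\<^sub>\<infinity>n. weight n * w powi n" and ?P = "\<lambda>x. q_pochhammer_inf x q"
  let ?R = "\<lambda>w. \<Sum>\<^sub>\<infinity>n. weight_rest n * w powi n"
  obtain \<kappa> where \<kappa>: "\<And>w. q < norm w \<Longrightarrow> norm w < 1 \<Longrightarrow>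
      ?F w * q_theta w q = \<kappa> * q_theta (- of_real t * w) q"
    using weight_theta_proportional by blast
  \<comment> \<open>For \<open>norm w \<ge> sqrt q\<close> the ratio \<open>q / norm w\<close> of the geometric bound is at most \<open>sqrt q < 1\<close>, which
     bounds the remainder uniformly near \<open>w = 1\<close>.\<close>
  define r where "r = sqrt q"
  have r: "0 < r" "r < 1" "q < r" "r * r = q"
    using q real_less_rsqrt[of q q] by (auto simp: r_def power2_eq_square)
  define B where "B = (\<Sum>\<^sub>\<infinity>n\<in>(UNIV :: int set). max t (inverse t) * r ^ nat \<bar>n\<bar>)"
  have R_bound: "norm (?R w) \<le> B" if "r \<le> norm w" "norm w \<le> 1" for w
  proof (rule norm_infsum_le)
    have qw: "q < norm w" using that r by linarith
    show "((\<lambda>n. weight_rest n * w powi n) has_sum ?R w) UNIV"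
      by (rule has_sum_infsum[OF summable_rest[OF qw that(2)]])
    show "((\<lambda>n. max t (inverse t) * r ^ nat \<bar>n\<bar>) has_sum B) UNIV"
      unfolding B_def using r
      by (intro has_sum_infsum summable_on_cmult_right summable_on_int_geometric) auto
    fix n :: int
    have "q / norm w \<le> r"
      using that r by (simp add: divide_le_eq) (metis mult_left_mono less_imp_le)
    then have "max t (inverse t) * (q / norm w) ^ nat \<bar>n\<bar> \<le> max t (inverse t) * r ^ nat \<bar>n\<bar>"
      using t q by (intro mult_left_mono power_mono) auto
    then show "norm (weight_rest n * w powi n) \<le> max t (inverse t) * r ^ nat \<bar>n\<bar>"
      using rest_term_bound[OF qw that(2), of n] by linarith
  qed
  let ?l = "at_left (1::real)"
  have near: "\<forall>\<^sub>F x in ?l. r < x \<and> x < 1"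
    using r eventually_at_left_field by blast
  have lim_id: "((\<lambda>x. complex_of_real x) \<longlongrightarrow> 1) ?l"
    using tendsto_of_real[OF tendsto_ident_at, of 1 "{..<1}"] by simp
  have "((\<lambda>x. (1 - of_real x) * ?R (of_real x)) \<longlongrightarrow> 0) ?l"
  proof (rule tendsto_0_le[where K = B])
    show "((\<lambda>x. 1 - complex_of_real x) \<longlongrightarrow> 0) ?l"
      using tendsto_diff[OF tendsto_const lim_id, of 1] by simp
    show "\<forall>\<^sub>F x in ?l. norm ((1 - of_real x) * ?R (of_real x)) \<le> norm (1 - complex_of_real x) * B"
      using near
    proof eventually_elim
      case (elim x)
      then have "norm (?R (of_real x)) \<le> B" using r by (intro R_bound) auto
      then show ?case by (simp add: norm_mult mult_left_mono)
    qed
  qed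
  from tendsto_add[OF tendsto_const this, of 1]
  have lim_F: "((\<lambda>x. 1 + (1 - of_real x) * ?R (of_real x)) \<longlongrightarrow> 1) ?l"
    by simp
  have P_lim: "((\<lambda>x. ?P (f x)) \<longlongrightarrow> ?P l) ?l" if "(f \<longlongrightarrow> l) ?l" for f l
    by (rule isCont_tendsto_compose[OF isCont_q_pochhammer_inf[OF q] that])
  have "((\<lambda>x. (1 + (1 - of_real x) * ?R (of_real x)) * (?P (of_real q * of_real x) * ?P (of_real q / of_real x)))
      \<longlongrightarrow> 1 * (?P (of_real q * 1) * ?P (of_real q / 1))) ?l"
    by (intro tendsto_mult lim_F P_lim tendsto_divide tendsto_const lim_id) auto
  moreover have "((\<lambda>x. \<kappa> * (?P (- of_real t * of_real x) * ?P (of_real q / (- of_real t * of_real x))))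
      \<longlongrightarrow> \<kappa> * (?P (- of_real t * 1) * ?P (of_real q / (- of_real t * 1)))) ?l"
    using t by (intro tendsto_mult P_lim tendsto_divide tendsto_const lim_id) auto
  moreover have "\<forall>\<^sub>F x in ?l.
      (1 + (1 - of_real x) * ?R (of_real x)) * (?P (of_real q * of_real x) * ?P (of_real q / of_real x))
      = \<kappa> * (?P (- of_real t * of_real x) * ?P (of_real q / (- of_real t * of_real x)))"
    using near
  proof eventually_elim
    case (elim x)
    let ?x = "complex_of_real x"
    have x: "q < norm ?x" "norm ?x < 1" "1 - ?x \<noteq> 0"
      using elim r by auto
    have cancel: "(1 / d + R) * (d * A * B) = (1 + d * R) * (A * B)" if "d \<noteq> 0" for d R A B :: complex
      using that by (simp add: field_simps)
    have "?F ?x = 1 / (1 - ?x) + ?R ?x"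
      by (rule infsumI[OF has_sum_weight[OF x(1,2)]])
    then have "?F ?x * q_theta ?x q
        = (1 + (1 - ?x) * ?R ?x) * (?P (of_real q * ?x) * ?P (of_real q / ?x))"
      unfolding q_theta_def q_pochhammer_inf_step[OF q, of ?x]
      by (simp only: cancel[OF x(3)])
    from trans[OF this[symmetric] \<kappa>[OF x(1,2)]] show ?case
      unfolding q_theta_def .
  qed
  ultimately have "1 * (?P (of_real q * 1) * ?P (of_real q / 1))
      = \<kappa> * (?P (- of_real t * 1) * ?P (of_real q / (- of_real t * 1)))"
    by (intro tendsto_unique[OF _ Lim_transform_eventually]) (auto)
  then have "(?P (of_real q))\<^sup>2 = \<kappa> * q_theta (- of_real t) q"
    by (simp add: power2_eq_square q_theta_def)
  then have "?F w * q_theta w q * q_theta (- of_real t) q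
      = (?P (of_real q))\<^sup>2 * q_theta (- of_real t * w) q"
    unfolding \<kappa>[OF w] by simp
  then show ?thesis
    using q_theta_minus_t_nonzero q_theta_ring_nonzero[OF w] by (simp add: field_simps)
qed

end

end

theorem mainTheorem5:
  fixes \<rho> t :: real and \<mu> \<nu> a z :: complex
  assumes "0 < \<rho>" and "\<rho> < 1" and "0 < t"
    and "\<mu> = (of_real (ln t) + \<i> * of_real pi) / of_real (2 * ln \<rho>)"
    and "\<nu> = 1 + (- of_real (ln t) + \<i> * of_real pi) / of_real (2 * ln \<rho>)"
    and "a \<in> annulus \<rho>"
    and "z \<in> annulus \<rho> \<union> annulus_boundary \<rho>"
  shows "weighted_szego \<rho> t z a =
    (q_Gamma (\<rho>\<^sup>2) \<mu> * q_Gamma (\<rho>\<^sup>2) \<nu> * q_theta (- of_real t * cnj a * z) (\<rho>\<^sup>2)) /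
    (2 * of_real pi * of_real (1 - \<rho>\<^sup>2) powr (2 - \<mu> - \<nu>) * q_theta (cnj a * z) (\<rho>\<^sup>2))"
proof -
  define q where "q = \<rho>\<^sup>2"
  define w where "w = cnj a * z"
  have q: "0 < q" "q < 1"
    using assms(1,2) by (auto simp: q_def power_less_one_iff)
  have ln_q: "ln q = 2 * ln \<rho>" "ln q \<noteq> 0"
    using assms(1,2) by (auto simp: q_def ln_realpow)
  have a: "\<rho> < norm a" "norm a < 1"
    using assms(6) by (auto simp: annulus_def)
  have z: "\<rho> \<le> norm z" "norm z \<le> 1"
    using assms(2,7) by (auto simp: annulus_def annulus_boundary_def)
  have "\<rho> * \<rho> < norm a * norm z"
    using a z assms(1) by (intro mult_less_le_imp_less) auto
  moreover have "norm a * norm z < 1"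
    using a z mult_left_le[of "norm z" "norm a"] norm_ge_zero[of a] by linarith
  ultimately have w: "q < norm w" "norm w < 1"
    by (simp_all add: w_def q_def norm_mult power2_eq_square)
  have powr_q: "complex_of_real q powr x = exp (x * of_real (ln q))" for x
    using q by (simp add: powr_def Ln_of_real)
  have "of_real (ln q) * \<mu> = of_real (ln t) + \<i> * of_real pi"
    using ln_q unfolding assms(4) by simp
  then have q_mu: "complex_of_real q powr \<mu> = - of_real t"
    using assms(3) by (simp add: powr_q mult.commute exp_add exp_of_real)
  have "of_real (ln q) * \<nu> = of_real (ln q) + (- of_real (ln t) + \<i> * of_real pi)"
    using ln_q(2) unfolding assms(5) ln_q(1)[symmetric] by (simp add: distrib_left)
  then have q_nu: "complex_of_real q powr \<nu> = of_real q / (- of_real t)"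
    unfolding powr_q mult.commute[of \<nu>] using assms(3) q
    by (simp add: exp_add exp_diff exp_minus exp_of_real mult.commute[of \<i>] inverse_eq_divide)
  let ?P = "q_pochhammer_inf (of_real q) q" and ?c = "complex_of_real (1 - q)"
  have powr_add': "?c powr (1 - \<mu>) * ?c powr (1 - \<nu>) = ?c powr (2 - \<mu> - \<nu>)"
    by (simp add: powr_add[symmetric] algebra_simps)
  have c: "?c powr (2 - \<mu> - \<nu>) \<noteq> 0"
    using q by (simp add: powr_eq_0_iff del: of_real_diff)
  have gamma: "q_Gamma q \<mu> * q_Gamma q \<nu> = ?P\<^sup>2 / q_theta (- of_real t) q * ?c powr (2 - \<mu> - \<nu>)"
    unfolding q_Gamma_def q_mu q_nu q_theta_def powr_add'[symmetric] by (simp add: power2_eq_square)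
  have "weight q t n = 1 / of_real (1 + t * \<rho> powi (2 * n))" for n
    unfolding weight_def[OF q assms(3)] by (simp add: q_def power_int_mult)
  then have "weighted_szego \<rho> t z a = 1 / (2 * of_real pi) * (\<Sum>\<^sub>\<infinity>n. weight q t n * w powi n)"
    unfolding weighted_szego_def w_def[symmetric] by simp
  then have szego: "weighted_szego \<rho> t z a = 1 / (2 * of_real pi) *
      (?P\<^sup>2 * q_theta (- of_real t * w) q / (q_theta (- of_real t) q * q_theta w q))"
    unfolding bilateral_sum[OF q assms(3) w] .
  have cancel: "1 / d * (x * y / (u * v)) = (x / u * p * y) / (d * p * v)"
    if "p \<noteq> 0" for d x y u v p :: complex
    using that by simp
  have "- of_real t * cnj a * z = - of_real t * w"
    by (simp add: w_def)
  then show ?thesis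
    unfolding szego q_def[symmetric] w_def[symmetric] gamma by (simp only: cancel[OF c])
qed

end
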